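(* Let $\mathcal{P}_n$ be the set of multigraphs on $[n]$ in which no triple of vertices supports more than $4$ edges counting multiplicities, i.e. maps $w:E(K_n)\to\{0,1,2,3,4\}$ with $w(ab)+w(bc)+w(ac)\le4$ for all distinct $a,b,c\in[n]$, viewed as $5$-colourings of $E(K_n)$ with colour set $\{0,1,2,3,4\}$. For all $n\ge3$, \[\mathrm{ex}(n,\mathcal{P})=\log_5(2)\binom n2+\log_5\!\left(\tfrac32\right)\left\lfloor\tfrac n2\right\rfloor.\]
   Context: A template for $K_n$ is a map $t:E(K_n)\to2^{\{0,1,2,3,4\}}\setminus\{\emptyset\}$; $\langle t\rangle$ is the set of maps $w$ with $w(e)\in t(e)$ for all $e$; $\mathrm{Ent}(t)=\sum_e\log_5|t(e)|$; and $\mathrm{ex}(n,\mathcal{P})=\max\{\mathrm{Ent}(t):\langle t\rangle\subseteq\mathcal{P}_n\}$. *)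

theory Defs
  imports Complex_Main "HOL-Library.FuncSet" "HOL-Library.Ramsey"
begin

text \<open>
  Edges are two-element vertex sets. Templates and colourings are extensional functions on the
  edge set, so that each of them is represented by exactly one HOL function.
\<close>

definition edges_K :: "nat \<Rightarrow> nat set set" where
  "edges_K n = nsets {1..n} 2"

definition colours :: "nat set" where
  "colours = {0, 1, 2, 3, 4}"

definition templates :: "nat \<Rightarrow> (nat set \<Rightarrow> nat set) set" where
  "templates n = edges_K n \<rightarrow>\<^sub>E (Pow colours - {{}})"

definition realisations :: "nat \<Rightarrow> (nat set \<Rightarrow> nat set) \<Rightarrow> (nat set \<Rightarrow> nat) set" where
  "realisations n t = (\<Pi>\<^sub>E e \<in> edges_K n. t e)"

definition Ent :: "nat \<Rightarrow> (nat set \<Rightarrow> nat set) \<Rightarrow> real" where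
  "Ent n t = (\<Sum>e \<in> edges_K n. log 5 (real (card (t e))))"

definition ex_entropy :: "nat \<Rightarrow> (nat \<Rightarrow> (nat set \<Rightarrow> nat) set) \<Rightarrow> real" where
  "ex_entropy n P = Max {Ent n t | t. t \<in> templates n \<and> realisations n t \<subseteq> P n}"

definition multigraphs_3_4 :: "nat \<Rightarrow> (nat set \<Rightarrow> nat) set" where
  "multigraphs_3_4 n =
    {w \<in> edges_K n \<rightarrow>\<^sub>E colours.
       \<forall>a\<in>{1..n}. \<forall>b\<in>{1..n}. \<forall>c\<in>{1..n}.
         a \<noteq> b \<and> b \<noteq> c \<and> a \<noteq> c \<longrightarrow> w {a, b} + w {b, c} + w {a, c} \<le> 4}"

text \<open>The maximum defining \<^const>\<open>ex_entropy\<close> is over a finite set, nonempty for the property at hand.\<close>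

lemma finite_templates: "finite (templates n)"
  unfolding templates_def edges_K_def colours_def
  by (intro finite_PiE finite_imp_finite_nsets) auto

lemma finite_ex_entropy_set:
  "finite {Ent n t | t. t \<in> templates n \<and> realisations n t \<subseteq> P n}"
  using finite_templates[of n] by auto

lemma ex_entropy_set_nonempty:
  "{Ent n t | t. t \<in> templates n \<and> realisations n t \<subseteq> multigraphs_3_4 n} \<noteq> {}"
proof -
  let ?t = "\<lambda>e\<in>edges_K n. {0::nat}"
  have "?t \<in> templates n"
    by (auto simp: templates_def colours_def)
  moreover have "realisations n ?t \<subseteq> multigraphs_3_4 n"
  proof
    fix w assume w: "w \<in> realisations n ?t"
    have 0: "w e = 0" if "e \<in> edges_K n" for e
      using PiE_mem[OF w[unfolded realisations_def] that] that by simp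
    have "w \<in> edges_K n \<rightarrow>\<^sub>E colours"
      using w 0 by (auto simp: realisations_def colours_def PiE_iff)
    moreover have "w {a, b} = 0" if "a \<in> {1..n}" "b \<in> {1..n}" "a \<noteq> b" for a b
      using that by (intro 0) (auto simp: edges_K_def nsets_def)
    ultimately show "w \<in> multigraphs_3_4 n"
      by (simp add: multigraphs_3_4_def)
  qed
  ultimately show ?thesis by blast
qed

end

theory Submission imports Defs begin

text \<open>
  Only the sizes \<open>s e = card (t e)\<close> matter: since \<open>Max (t e) \<ge> s e - 1\<close>, the sizes on every triangle
  sum to at most 7. For the upper bound, remove the two ends of an edge \<open>{u, v}\<close> of maximal size
  \<open>k\<close>. If \<open>k \<le> 2\<close> everything is at most 2. Otherwise \<open>s {u, w} + s {v, w} \<le> 7 - k\<close> for every other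
  vertex \<open>w\<close>, so the removed edges contribute a factor of at most \<open>3 * 4 ^ (n - 2)\<close>, which is the
  ratio of the claimed bounds for \<open>n\<close> and \<open>n - 2\<close>. The bound fails for two vertices, and \<open>n = 4\<close>
  is where maximality of \<open>k\<close> is needed. Equality holds for a maximum matching of edges
  \<open>{0, 1, 2}\<close> with \<open>{0, 1}\<close> elsewhere.
\<close>

section \<open>Edge products and the multiplicative form of the bound\<close>

lemma nsets_insert_2:
  assumes "u \<notin> W"
  shows "nsets (insert u W) 2 = nsets W 2 \<union> (\<lambda>w. {u, w}) ` W"
  using assms unfolding nsets_2_eq by (auto simp: insert_commute)

lemma prod_nsets_insert_2:
  fixes f :: "'a set \<Rightarrow> 'b::comm_monoid_mult"
  assumes "finite W" "u \<notin> W"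
  shows "prod f (nsets (insert u W) 2) = prod f (nsets W 2) * (\<Prod>w\<in>W. f {u, w})"
proof -
  have "nsets W 2 \<inter> (\<lambda>w. {u, w}) ` W = {}"
    using assms(2) by (auto simp: nsets_def)
  moreover have "inj_on (\<lambda>w. {u, w}) W"
    using assms(2) by (auto simp: inj_on_def doubleton_eq_iff)
  ultimately show ?thesis
    using assms by (simp add: nsets_insert_2 prod.union_disjoint prod.reindex finite_imp_finite_nsets)
qed

text \<open>This is 5 raised to the claimed extremal entropy, so the induction can work with
  products of sizes and take logarithms only at the end.\<close>

definition entropy_bound :: "nat \<Rightarrow> real" where
  "entropy_bound n = 2 ^ (n choose 2) * (3 / 2) ^ (n div 2)"

text \<open>Two new vertices add \<open>2 * n + 1\<close> edges and one matching edge, and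
  \<open>2 ^ (2 * n + 1) * (3 / 2) = 3 * 4 ^ n\<close>.\<close>

lemma entropy_bound_add_2: "entropy_bound (n + 2) = 3 * 4 ^ n * entropy_bound n"
proof -
  have "(n + 2) choose 2 = 2 * n + 1 + (n choose 2)"
    by (simp add: numeral_2_eq_2)
  then show ?thesis
    by (simp add: entropy_bound_def power_add power_mult)
qed

text \<open>The sum \<open>a + b\<close> is at most 4, 3 or 2 for \<open>k\<close> equal to 3, 4 or
  5, and the most balanced split gives 4, 2 or 1. Larger \<open>k\<close> contradicts
  \<open>a, b \<ge> 1\<close>.\<close>

lemma mult_le_of_add_le:
  fixes a b k :: nat
  assumes "a \<ge> 1" "b \<ge> 1" "k \<ge> 3" "k + a + b \<le> 7"
  shows "a * b \<le> (if k = 3 then 4 else if k = 4 then 2 else 1)"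
proof -
  have "a \<in> {1, 2, 3}" "b \<in> {1, 2, 3}" using assms by auto
  then show ?thesis using assms by auto
qed

text \<open>Equality holds at \<open>k = 3\<close>. For \<open>k\<close> equal to 4 or 5 the loss in
  the power outweighs the larger factor \<open>k\<close>, but only once \<open>m \<ge> 1\<close>: at
  \<open>m = 0\<close> the claim would read \<open>k \<le> 3\<close>.\<close>

lemma mult_power_le:
  assumes "3 \<le> k" "k \<le> 5" "m \<ge> 1"
  shows "k * (if k = 3 then 4 else if k = 4 then 2 else 1 :: nat) ^ m \<le> 3 * 4 ^ m"
proof -
  obtain j where j: "m = Suc j" using assms(3) by (cases m) auto
  have "(2::nat) ^ j \<le> 4 ^ j" "(0::nat) < 4 ^ j" by (auto intro: power_mono)
  then have "4 * (2 * (2::nat) ^ j) \<le> 3 * (4 * 4 ^ j)" "5 \<le> 3 * (4 * (4::nat) ^ j)" by linarith+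
  moreover have "k \<in> {3, 4, 5}" using assms by auto
  ultimately show ?thesis by (auto simp: j)
qed

text \<open>With two vertices there is no triangle to limit the single edge, hence
  \<open>card V \<noteq> 2\<close>. Stating the result for arbitrary finite \<open>V\<close> lets
  the induction pass to a subset without relabelling.\<close>

lemma prod_le_entropy_bound:
  fixes s :: "'a set \<Rightarrow> nat"
  assumes "finite V" "card V \<noteq> 2"
    and "\<And>e. e \<in> nsets V 2 \<Longrightarrow> s e \<ge> 1"
    and "\<And>a b c. \<lbrakk>a \<in> V; b \<in> V; c \<in> V; a \<noteq> b; b \<noteq> c; a \<noteq> c\<rbrakk>
          \<Longrightarrow> s {a, b} + s {b, c} + s {a, c} \<le> 7"
  shows "real (\<Prod>e\<in>nsets V 2. s e) \<le> entropy_bound (card V)"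
  using assms
proof (induction "card V" arbitrary: V rule: less_induct)
  case less
  note finV = \<open>finite V\<close> and s_pos = less.prems(3) and s_tri = less.prems(4)
  have fin: "finite (nsets V 2)" using finV by (rule finite_imp_finite_nsets)
  show ?case
  \<comment> \<open>The first case also covers \<open>card V \<le> 1\<close>, where there are no
    edges.\<close>
  proof (cases "\<forall>e\<in>nsets V 2. s e \<le> 2")
    case True
    then have "(\<Prod>e\<in>nsets V 2. s e) \<le> 2 ^ (card V choose 2)"
      using prod_mono[of "nsets V 2" s "\<lambda>_. 2"] by simp
    then have "real (\<Prod>e\<in>nsets V 2. s e) \<le> 2 ^ (card V choose 2)"
      by (metis of_nat_le_iff of_nat_numeral of_nat_power)
    also have "\<dots> \<le> entropy_bound (card V)"
      by (simp add: entropy_bound_def)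
    finally show ?thesis .
  next
    case False
    then have ne: "nsets V 2 \<noteq> {}" by auto
    obtain e where e: "e \<in> nsets V 2" and e_max: "\<And>e'. e' \<in> nsets V 2 \<Longrightarrow> s e' \<le> s e"
    proof -
      have "Max (s ` nsets V 2) \<in> s ` nsets V 2" using fin ne by simp
      then obtain e where "e \<in> nsets V 2" "s e = Max (s ` nsets V 2)" by (metis imageE)
      then show ?thesis using that fin by (metis Max_ge finite_imageI imageI)
    qed
    define k where "k = s e"
    have k3: "k \<ge> 3" using False e_max unfolding k_def by fastforce
    obtain u v where uv: "e = {u, v}" "u \<in> V" "v \<in> V" "u \<noteq> v"
      using e by (auto simp: nsets_2_eq)
    define W where "W = V - {u, v}"
    have V: "V = insert u (insert v W)" and W: "u \<notin> W" "v \<notin> W" "finite W"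
      using uv finV by (auto simp: W_def)
    have cardV: "card V = card W + 2" using V W uv by simp
    \<comment> \<open>A third vertex exists, and its triangle with \<open>u\<close> and
      \<open>v\<close> will force \<open>k \<le> 5\<close>.\<close>
    then have cW: "card W \<ge> 1" using less.prems(2) by simp
    define p where "p = (if k = 3 then 4 else if k = 4 then 2 else 1 :: nat)"
    have tri: "1 \<le> s {u, w}" "1 \<le> s {v, w}" "k + s {u, w} + s {v, w} \<le> 7" if "w \<in> W" for w
    proof -
      have "{u, w} \<in> nsets V 2" "{v, w} \<in> nsets V 2"
        using that W V by (auto simp: nsets_def card_insert_if)
      then show "1 \<le> s {u, w}" "1 \<le> s {v, w}" using s_pos by auto
      show "k + s {u, w} + s {v, w} \<le> 7"
      proof -
        have "w \<noteq> u" "w \<noteq> v" "w \<in> V" using that by (auto simp: W_def)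
        then show ?thesis using s_tri[of u v w] uv by (simp add: k_def)
      qed
    qed
    have k5: "k \<le> 5"
    proof -
      obtain w where "w \<in> W" using cW by fastforce
      then show ?thesis using tri[of w] by simp
    qed
    have star: "(\<Prod>w\<in>W. s {u, w} * s {v, w}) \<le> p ^ card W"
      using prod_mono[of W "\<lambda>w. s {u, w} * s {v, w}" "\<lambda>_. p"]
        mult_le_of_add_le[OF tri(1) tri(2) k3 tri(3)] by (simp add: p_def)
    have split: "(\<Prod>e\<in>nsets V 2. s e)
        = k * (\<Prod>w\<in>W. s {u, w} * s {v, w}) * (\<Prod>e\<in>nsets W 2. s e)"
      using W uv unfolding V by (simp add: prod_nsets_insert_2 prod.distrib k_def)
    have removed: "k * (\<Prod>w\<in>W. s {u, w} * s {v, w}) \<le> k * p ^ card W"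
      using star by simp
    have subW: "nsets W 2 \<subseteq> nsets V 2" by (rule nsets_mono) (auto simp: V)
    show ?thesis
    proof (cases "card W = 2")
      case True
      then obtain x y where xy: "W = {x, y}" "x \<noteq> y" by (meson card_2_iff)
      then have xyE: "nsets W 2 = {{x, y}}"
        by (auto simp: nsets_2_eq doubleton_eq_iff)
      then have "s {x, y} \<le> k" using e_max subW by (auto simp: k_def)
      then have "(\<Prod>e\<in>nsets V 2. s e) \<le> k * p ^ 2 * k"
        unfolding split using removed True xyE by (auto intro: mult_mono)
      \<comment> \<open>The values for \<open>k\<close> equal to 3, 4, 5 are 144, 64, 25, and
        \<open>entropy_bound 4 = 2 ^ 6 * (3 / 2) ^ 2 = 144\<close>.\<close>
      moreover have "k * p ^ 2 * k \<le> 144"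
      proof -
        have "k \<in> {3, 4, 5}" using k3 k5 by auto
        then show ?thesis by (auto simp: p_def)
      qed
      ultimately have "(\<Prod>e\<in>nsets V 2. s e) \<le> 144" by linarith
      then have "real (\<Prod>e\<in>nsets V 2. s e) \<le> 144" by linarith
      also have "144 = entropy_bound (card V)"
        using cardV True by (simp add: entropy_bound_def choose_two power2_eq_square)
      finally show ?thesis .
    next
      case False
      have IH: "real (\<Prod>e\<in>nsets W 2. s e) \<le> entropy_bound (card W)"
      proof (rule less.hyps)
        show "card W < card V" using cardV by simp
        show "s e \<ge> 1" if "e \<in> nsets W 2" for e using that subW s_pos by blast
        show "s {a, b} + s {b, c} + s {a, c} \<le> 7"
          if "a \<in> W" "b \<in> W" "c \<in> W" "a \<noteq> b" "b \<noteq> c" "a \<noteq> c" for a b c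
          using that by (intro s_tri) (auto simp: V)
      qed (use W False in auto)
      have "k * (\<Prod>w\<in>W. s {u, w} * s {v, w}) \<le> 3 * 4 ^ card W"
        using removed mult_power_le[OF k3 k5 cW] unfolding p_def by (rule order_trans)
      then have "real (k * (\<Prod>w\<in>W. s {u, w} * s {v, w})) \<le> real (3 * 4 ^ card W)"
        by (rule of_nat_mono)
      then have "real (\<Prod>e\<in>nsets V 2. s e) \<le> real (3 * 4 ^ card W) * entropy_bound (card W)"
        unfolding split of_nat_mult[of "k * _"] using IH by (rule mult_mono) (auto intro: prod_nonneg)
      then show ?thesis unfolding cardV entropy_bound_add_2 by simp
    qed
  qed
qed

section \<open>Upper bound: from sizes to entropy\<close>

lemma log_entropy_bound:
  "log 5 (entropy_bound n) = log 5 2 * real (n choose 2) + log 5 (3 / 2) * real (n div 2)"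
  by (simp add: entropy_bound_def log_mult log_nat_power)

lemma Ent_eq_log_prod:
  assumes "\<And>e. e \<in> edges_K n \<Longrightarrow> card (t e) \<ge> 1"
  shows "Ent n t = log 5 (real (\<Prod>e\<in>edges_K n. card (t e)))"
proof -
  have "finite (edges_K n)" by (simp add: edges_K_def finite_imp_finite_nsets)
  moreover have "real (card (t e)) \<noteq> 0" if "e \<in> edges_K n" for e
    using assms[OF that] by simp
  ultimately show ?thesis
    by (simp add: Ent_def log_def ln_prod sum_divide_distrib)
qed

text \<open>This turns a bound on colours into a bound on sizes, at a cost of 1 per edge.\<close>

lemma card_le_Suc_Max:
  fixes A :: "nat set"
  assumes "finite A"
  shows "card A \<le> Suc (Max A)"
  using card_mono[of "{..Max A}" A] assms by (simp add: subset_iff)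

lemma Ent_le:
  assumes n: "n \<ge> 3" and t: "t \<in> templates n" and P: "realisations n t \<subseteq> multigraphs_3_4 n"
  shows "Ent n t \<le> log 5 (entropy_bound n)"
proof -
  have te: "finite (t e)" "t e \<noteq> {}" if "e \<in> edges_K n" for e
    using PiE_mem[OF t[unfolded templates_def] that]
    by (auto simp: colours_def intro: finite_subset)
  have pos: "card (t e) \<ge> 1" if "e \<in> edges_K n" for e
    using te[OF that] by (simp add: Suc_le_eq card_gt_0_iff)
  \<comment> \<open>The realisation with the largest colour on every edge carries the whole
    constraint: its triangle sums are at most 4, so the sizes sum to at most 4 + 3 = 7.\<close>
  define w where "w = (\<lambda>e\<in>edges_K n. Max (t e))"
  have "w \<in> realisations n t" using te by (simp add: w_def realisations_def)
  then have w: "w \<in> multigraphs_3_4 n" using P by blast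
  have ab: "{a, b} \<in> edges_K n" if "a \<in> {1..n}" "b \<in> {1..n}" "a \<noteq> b" for a b
    using that by (auto simp: edges_K_def nsets_def)
  have card_w: "card (t e) \<le> Suc (w e)" if "e \<in> edges_K n" for e
    using card_le_Suc_Max te that by (simp add: w_def)
  have "real (\<Prod>e\<in>nsets {1..n} 2. card (t e)) \<le> entropy_bound (card {1..n})"
  proof (rule prod_le_entropy_bound)
    show "card (t e) \<ge> 1" if "e \<in> nsets {1..n} 2" for e
      using pos that by (simp add: edges_K_def)
    show "card (t {a, b}) + card (t {b, c}) + card (t {a, c}) \<le> 7"
      if "a \<in> {1..n}" "b \<in> {1..n}" "c \<in> {1..n}" "a \<noteq> b" "b \<noteq> c" "a \<noteq> c" for a b c
    proof -
      have "w {a, b} + w {b, c} + w {a, c} \<le> 4"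
        using w that by (auto simp: multigraphs_3_4_def)
      then show ?thesis
        using card_w[OF ab[of a b]] card_w[OF ab[of b c]] card_w[OF ab[of a c]] that by simp
    qed
  qed (use n in auto)
  moreover have "real (\<Prod>e\<in>edges_K n. card (t e)) > 0"
    using pos by (auto intro!: prod_pos simp: Suc_le_eq)
  ultimately show ?thesis
    using Ent_eq_log_prod[OF pos] by (simp add: edges_K_def)
qed

section \<open>Lower bound: the template of a maximum matching\<close>

definition matching :: "nat \<Rightarrow> nat set set" where
  "matching n = (\<lambda>i. {2 * i + 1, 2 * i + 2}) ` {..<n div 2}"

text \<open>The largest vertex used is \<open>2 * (n div 2)\<close>, so for odd \<open>n\<close>
  only the vertex \<open>n\<close> stays unmatched.\<close>

lemma matching_subset: "matching n \<subseteq> edges_K n"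
  by (auto simp: matching_def edges_K_def nsets_def)

lemma card_matching: "card (matching n) = n div 2"
proof -
  have "inj_on (\<lambda>i::nat. {2 * i + 1, 2 * i + 2}) {..<n div 2}"
    by (auto simp: inj_on_def doubleton_eq_iff)
  then show ?thesis by (simp add: matching_def card_image)
qed

text \<open>Either end \<open>b\<close> of a pair determines its index as
  \<open>(b - 1) div 2\<close>, so two pairs sharing \<open>b\<close> coincide.\<close>

lemma matching_disjoint:
  assumes "{a, b} \<in> matching n" "{b, c} \<in> matching n"
  shows "a = c"
proof -
  obtain i j where i: "{a, b} = {2 * i + 1, 2 * i + 2}" and j: "{b, c} = {2 * j + 1, 2 * j + 2}"
    using assms by (auto simp: matching_def)
  then have "(b - 1) div 2 = i" "(b - 1) div 2 = j"
    by (auto simp: doubleton_eq_iff)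
  with i j show ?thesis by (auto simp: doubleton_eq_iff)
qed

definition matching_template :: "nat \<Rightarrow> nat set \<Rightarrow> nat set" where
  "matching_template n = (\<lambda>e\<in>edges_K n. if e \<in> matching n then {0, 1, 2} else {0, 1})"

lemma matching_template_in_templates: "matching_template n \<in> templates n"
  by (auto simp: matching_template_def templates_def colours_def)

lemma realisations_matching_template:
  "realisations n (matching_template n) \<subseteq> multigraphs_3_4 n"
proof
  fix w assume w: "w \<in> realisations n (matching_template n)"
  have we: "w e \<le> (if e \<in> matching n then 2 else 1)" if "e \<in> edges_K n" for e
    using PiE_mem[OF w[unfolded realisations_def] that] that
    by (auto simp: matching_template_def split: if_splits)
  have ran: "w \<in> edges_K n \<rightarrow>\<^sub>E colours"
  proof (rule PiE_I)
    show "w e \<in> colours" if "e \<in> edges_K n" for e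
      using we[OF that] by (auto simp: colours_def split: if_splits)
    show "w e = undefined" if "e \<notin> edges_K n" for e
      using w that by (auto simp: realisations_def)
  qed
  have "w {a, b} + w {b, c} + w {a, c} \<le> 4"
    if "a \<in> {1..n}" "b \<in> {1..n}" "c \<in> {1..n}" "a \<noteq> b" "b \<noteq> c" "a \<noteq> c" for a b c
  proof -
    have "{a, b} \<in> edges_K n" "{b, c} \<in> edges_K n" "{a, c} \<in> edges_K n"
      using that by (auto simp: edges_K_def nsets_def)
    note this[THEN we]
    \<comment> \<open>Any two edges of a triangle share a vertex, so at most one is a matching edge
      and the sum is at most 2 + 1 + 1.\<close>
    moreover have "\<not> ({a, b} \<in> matching n \<and> {b, c} \<in> matching n)"
      "\<not> ({a, b} \<in> matching n \<and> {a, c} \<in> matching n)"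
      "\<not> ({b, c} \<in> matching n \<and> {a, c} \<in> matching n)"
      using matching_disjoint[of a b n c] matching_disjoint[of b a n c]
        matching_disjoint[of b c n a] that by (auto simp: insert_commute)
    ultimately show ?thesis by (auto split: if_splits)
  qed
  with ran show "w \<in> multigraphs_3_4 n" by (simp add: multigraphs_3_4_def)
qed

lemma Ent_matching_template: "Ent n (matching_template n) = log 5 (entropy_bound n)"
proof -
  have fin: "finite (edges_K n)" by (simp add: edges_K_def finite_imp_finite_nsets)
  have card_E: "card (edges_K n) = n choose 2" by (simp add: edges_K_def)
  \<comment> \<open>A matching edge contributes \<open>log 5 3 = log 5 2 + log 5 (3 / 2)\<close>,
    which isolates the surplus over \<open>log 5 2\<close>.\<close>
  have "Ent n (matching_template n)
      = (\<Sum>e\<in>edges_K n. log 5 2 + (if e \<in> matching n then log 5 (3 / 2) else 0))"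
    unfolding Ent_def
    by (intro sum.cong) (auto simp: matching_template_def log_divide)
  also have "\<dots> = real (n choose 2) * log 5 2 + real (n div 2) * log 5 (3 / 2)"
    using fin matching_subset[of n]
    by (simp add: sum.distrib card_E card_matching Int_absorb1 flip: sum.inter_restrict)
  finally show ?thesis by (simp add: log_entropy_bound mult.commute)
qed

theorem theorem4p10:
  fixes n :: nat
  assumes "n \<ge> 3"
  shows "ex_entropy n multigraphs_3_4 =
    log 5 2 * real (n choose 2) + log 5 (3 / 2) * of_int \<lfloor>real n / 2\<rfloor>"
proof -
  have "ex_entropy n multigraphs_3_4 = log 5 (entropy_bound n)"
    unfolding ex_entropy_def
  proof (rule Max_eqI)
    show "log 5 (entropy_bound n)
        \<in> {Ent n t | t. t \<in> templates n \<and> realisations n t \<subseteq> multigraphs_3_4 n}"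
      using matching_template_in_templates realisations_matching_template Ent_matching_template
      by (metis (mono_tags, lifting) mem_Collect_eq)
  qed (use finite_ex_entropy_set Ent_le[OF assms] in auto)
  moreover have "\<lfloor>real n / 2\<rfloor> = int (n div 2)"
    using floor_divide_of_nat_eq[of n 2, where ?'a = real] by simp
  ultimately show ?thesis by (simp add: log_entropy_bound)
qed

end
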